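(* (The nontrivial cases of Bennett's conjecture.) Let $0<\alpha<1$. Then for every convergent series $\sum_{n\ge1} a_n$ with $a_n\ge 0$, $$\sum_{n=1}^{\infty}\ \prod_{k=1}^{n}a_k^{\,k^{\alpha}/\sum_{i=1}^{n}i^{\alpha}}\ \le\ e^{1/(\alpha+1)}\sum_{n=1}^{\infty}a_n .$$ *)

theory Defs
  imports Complex_Main
begin

text \<open>
  Sequences are indexed from 1 and the value \<open>a 0\<close> is irrelevant; the series over
  \<open>n \<ge> 1\<close> are written by shifting the summation index. All exponents below are positive, so
  the library convention \<open>0 powr x = 0\<close> agrees with the usual meaning when some \<open>a k\<close> is 0.
\<close>

definition weighted_geo_mean :: "real \<Rightarrow> (nat \<Rightarrow> real) \<Rightarrow> nat \<Rightarrow> real" where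
  "weighted_geo_mean \<alpha> a n =
     (\<Prod>k=1..n. a k powr (real k powr \<alpha> / (\<Sum>i=1..n. real i powr \<alpha>)))"

end

(* Put x n = W n / w n, where W n = w 1 + ... + w n.  Polya's proof of Carleman's inequality,
   with multipliers c k chosen so that the weighted geometric mean of c 1, ..., c n is x (n + 1),
   gives the constant exp M for any weights with x n * ln (x (n + 1) / x n) \<le> M.
   For w n = n powr \<alpha> one has x (n + 1) - x n = 1 - x n * (1 - (n / (n + 1)) powr \<alpha>), and
   M = 1 / (\<alpha> + 1) is admissible because x n \<le> n and, by the Levin-Steckin bound
   W n \<ge> n * (n + 1) powr \<alpha> / (\<alpha> + 1), the increment of x is at most
   1 / (\<alpha> + 1) plus the quadratic term in the expansion of x n * exp (1 / ((\<alpha> + 1) * x n)). *)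
theory Submission
  imports Defs "HOL-Analysis.Convex"
begin

text \<open>Jensen's inequality for \<open>exp\<close> at the points \<open>ln (y i)\<close>. Zero
  values are split off first, because \<open>exp (ln 0)\<close> is not 0.\<close>

lemma weighted_arith_geom_mean:
  fixes p y :: "'a \<Rightarrow> real"
  assumes "finite S" and "(\<Sum>i\<in>S. p i) = 1"
    and p: "\<And>i. i \<in> S \<Longrightarrow> p i \<ge> 0" and y: "\<And>i. i \<in> S \<Longrightarrow> y i \<ge> 0"
  shows "(\<Prod>i\<in>S. y i powr p i) \<le> (\<Sum>i\<in>S. p i * y i)"
proof (cases "\<exists>i\<in>S. y i = 0")
  case True
  \<comment> \<open>\<open>0 powr p i = 0\<close> holds even for \<open>p i = 0\<close>, so a single
    zero value annihilates the product.\<close>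
  then have "(\<Prod>i\<in>S. y i powr p i) = 0"
    using \<open>finite S\<close> by auto
  then show ?thesis
    by (simp add: sum_nonneg p y)
next
  case False
  then have pos: "\<And>i. i \<in> S \<Longrightarrow> y i > 0"
    using y by force
  have "S \<noteq> {}"
    using assms(2) by auto
  have "exp (\<Sum>i\<in>S. p i *\<^sub>R ln (y i)) \<le> (\<Sum>i\<in>S. p i * exp (ln (y i)))"
    using \<open>finite S\<close> \<open>S \<noteq> {}\<close> assms(2) p
    by (intro convex_on_sum[OF _ _ exp_convex]) auto
  then show ?thesis
    using pos \<open>finite S\<close> by (simp add: exp_sum powr_def less_imp_neq[symmetric])
qed

lemma weighted_carleman:
  fixes w a :: "nat \<Rightarrow> real" and M :: real
  defines "W \<equiv> \<lambda>n. \<Sum>i=1..n. w i"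
  assumes w: "\<And>n. n \<ge> 1 \<Longrightarrow> w n > 0" and a: "\<And>n. n \<ge> 1 \<Longrightarrow> a n \<ge> 0"
    and ratio: "\<And>n. n \<ge> 1 \<Longrightarrow> W n / w n * ln ((W (Suc n) / w (Suc n)) / (W n / w n)) \<le> M"
    and summable: "summable (\<lambda>n. a (Suc n))"
  defines "G \<equiv> \<lambda>n. \<Prod>k=1..n. a k powr (w k / W n)"
  shows "summable (\<lambda>n. G (Suc n))"
    and "(\<Sum>n. G (Suc n)) \<le> exp M * (\<Sum>n. a (Suc n))"
proof -
  define x where "x n = W n / w n" for n
  \<comment> \<open>\<open>L k\<close> is the logarithm of the multiplier c k. The numerators
    telescope when summed, and at k = 1 the term with \<open>W 0 = 0\<close> drops out.\<close>
  define L where "L k = (W k * ln (x (Suc k)) - W (k - 1) * ln (x k)) / w k" for k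
  define S where "S n = (\<Sum>k=1..n. w k * (exp (L k) * a k))" for n
  have W_pos: "W n > 0" if "n \<ge> 1" for n
    unfolding W_def using that w by (intro sum_pos) auto
  have x_pos: "x n > 0" if "n \<ge> 1" for n
    using that w W_pos by (simp add: x_def)
  have W_Suc: "W (Suc n) = W n + w (Suc n)" for n
    by (simp add: W_def)
  \<comment> \<open>Since \<open>W (n - 1) / w n = x n - 1\<close>, \<open>L n\<close> is
    \<open>ln (x n)\<close> plus exactly the quantity bounded in \<open>ratio\<close>.\<close>
  have c_le: "w n * exp (L n) \<le> exp M * W n" if "n \<ge> 1" for n
  proof -
    have "W (n - 1) = W n - w n"
      using that W_Suc[of "n - 1"] by simp
    then have "L n = x n * (ln (x (Suc n)) - ln (x n)) + ln (x n)"
      using w[OF that]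
      by (simp add: L_def x_def diff_divide_distrib left_diff_distrib right_diff_distrib)
    also have "\<dots> \<le> M + ln (x n)"
      using ratio[OF that] x_pos[OF that] x_pos[of "Suc n"]
      by (simp add: x_def[symmetric] ln_div)
    finally have "exp (L n) \<le> exp M * x n"
      using x_pos[OF that] by (metis exp_add exp_le_cancel_iff exp_ln)
    then show ?thesis
      using w[OF that] by (simp add: x_def field_simps)
  qed
  \<comment> \<open>The mean of the multipliers is \<open>x (Suc n)\<close>, so AM-GM gives
    \<open>S n / (W n * x (Suc n))\<close>. The factor \<open>w (Suc n) / (W n * W (Suc n))\<close>
    is a difference of reciprocals.\<close>
  have G_le: "G n \<le> S n * (1 / W n - 1 / W (Suc n))" if "n \<ge> 1" for n
  proof -
    have "(\<Sum>k=1..m. w k * L k) = W m * ln (x (Suc m))" for m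
    proof (induction m)
      case 0
      show ?case by (simp add: W_def)
    next
      case (Suc m)
      then show ?case
        using w[of "Suc m"] by (simp add: L_def)
    qed
    then have "ln (x (Suc n)) = (\<Sum>k=1..n. w k * L k) / W n"
      using W_pos[OF that] by simp
    then have "x (Suc n) = exp (\<Sum>k=1..n. w k * L k / W n)"
      using x_pos[of "Suc n"] by (metis exp_ln le_add1 plus_1_eq_Suc sum_divide_distrib)
    then have "x (Suc n) = (\<Prod>k=1..n. exp (L k) powr (w k / W n))"
      by (simp add: exp_sum powr_def)
    then have "x (Suc n) * G n = (\<Prod>k=1..n. (exp (L k) * a k) powr (w k / W n))"
      using a by (simp add: G_def prod.distrib[symmetric] powr_mult)
    also have "\<dots> \<le> (\<Sum>k=1..n. w k / W n * (exp (L k) * a k))"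
      using W_pos[OF that] w a
      by (intro weighted_arith_geom_mean)
        (auto simp: sum_divide_distrib[symmetric] less_imp_le, simp add: W_def)
    also have "\<dots> = S n / W n"
      by (simp add: S_def sum_divide_distrib)
    finally have "G n \<le> S n / W n / x (Suc n)"
      using x_pos[of "Suc n"] by (metis le_add1 mult.commute plus_1_eq_Suc pos_le_divide_eq)
    also have "\<dots> = S n * (1 / W n - 1 / W (Suc n))"
      using W_pos[OF that] W_pos[of "Suc n"] w[of "Suc n"]
      by (simp add: x_def W_Suc field_simps)
    finally show ?thesis .
  qed
  \<comment> \<open>Summation by parts as an induction: \<open>S N / W (Suc N)\<close> is the
    boundary term. Each step costs at most \<open>exp M * a (Suc N)\<close> by
    \<open>c_le\<close>.\<close>
  have potential: "(\<Sum>n<N. G (Suc n)) + S N / W (Suc N) \<le> exp M * (\<Sum>n<N. a (Suc n))" for N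
  proof (induction N)
    case 0
    show ?case by (simp add: S_def)
  next
    case (Suc N)
    have "S (Suc N) = S N + w (Suc N) * exp (L (Suc N)) * a (Suc N)"
      by (simp add: S_def)
    also have "\<dots> \<le> S N + exp M * W (Suc N) * a (Suc N)"
      using c_le[of "Suc N"] a[of "Suc N"] by (simp add: mult_right_mono)
    finally have "S (Suc N) / W (Suc N) \<le> S N / W (Suc N) + exp M * a (Suc N)"
      using W_pos[of "Suc N"] by (simp add: field_simps)
    with Suc G_le[of "Suc N"] show ?case
      by (simp add: algebra_simps)
  qed
  have bound: "(\<Sum>n<N. G (Suc n)) \<le> exp M * (\<Sum>n. a (Suc n))" for N
  proof -
    have "S N \<ge> 0"
      unfolding S_def using w a by (intro sum_nonneg) (auto simp: less_imp_le)
    then have "S N / W (Suc N) \<ge> 0"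
      using W_pos[of "Suc N"] by simp
    moreover have "(\<Sum>n<N. a (Suc n)) \<le> (\<Sum>n. a (Suc n))"
      using summable a by (intro sum_le_suminf) auto
    then have "exp M * (\<Sum>n<N. a (Suc n)) \<le> exp M * (\<Sum>n. a (Suc n))"
      by simp
    ultimately show ?thesis
      using potential[of N] by linarith
  qed
  have "G n \<ge> 0" for n
    by (simp add: G_def prod_nonneg)
  then show "summable (\<lambda>n. G (Suc n))"
    using bound by (intro summableI_nonneg_bounded) auto
  then show "(\<Sum>n. G (Suc n)) \<le> exp M * (\<Sum>n. a (Suc n))"
    using bound by (intro suminf_le_const)
qed

text \<open>Young's inequality for 1 + h and 1 with weights \<alpha> and 1 - \<alpha>.\<close>

lemma powr_Bernoulli_le:
  fixes \<alpha> h :: real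
  assumes "0 \<le> \<alpha>" "\<alpha> \<le> 1" "h \<ge> 0"
  shows "(1 + h) powr \<alpha> \<le> 1 + \<alpha> * h"
  using Youngs_inequality_0[of \<alpha> "1 - \<alpha>" "1 + h" 1] assms by (simp add: algebra_simps)

text \<open>Follows from the upper bound for the exponent 1 - \<alpha> by writing
  \<open>(1 + h) powr \<alpha>\<close> as a quotient. The quadratic coefficient, twice that of
  Taylor, makes the quadratic terms cancel after clearing the denominator, leaving only a cubic term
  of favourable sign.\<close>

lemma powr_Bernoulli_ge:
  fixes \<alpha> h :: real
  assumes "0 \<le> \<alpha>" "\<alpha> \<le> 1" "h \<ge> 0"
  shows "(1 + h) powr \<alpha> \<ge> 1 + \<alpha> * h - \<alpha> * (1 - \<alpha>) * h\<^sup>2"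
proof -
  have pos: "1 + (1 - \<alpha>) * h > 0"
    using assms by (simp add: add_pos_nonneg)
  have "\<alpha> * ((1 - \<alpha>)\<^sup>2 * h ^ 3) \<ge> 0"
    using assms by simp
  then have "(1 + \<alpha> * h - \<alpha> * (1 - \<alpha>) * h\<^sup>2) * (1 + (1 - \<alpha>) * h) \<le> 1 + h"
    by (simp add: algebra_simps power2_eq_square power3_eq_cube)
  then have "1 + \<alpha> * h - \<alpha> * (1 - \<alpha>) * h\<^sup>2 \<le> (1 + h) / (1 + (1 - \<alpha>) * h)"
    using pos by (simp add: pos_le_divide_eq)
  also have "\<dots> \<le> (1 + h) / (1 + h) powr (1 - \<alpha>)"
    using assms powr_Bernoulli_le[of "1 - \<alpha>" h] pos by (intro divide_left_mono) auto
  also have "\<dots> = (1 + h) powr \<alpha>"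
    using assms by (simp add: powr_diff)
  finally show ?thesis .
qed

text \<open>With t = n + 1, the induction step reduces to \<open>t * (t + 1) powr \<alpha> \<le> t
  powr \<alpha> * (t + \<alpha>)\<close>, which is Bernoulli at h = 1 / t.\<close>

lemma Levin_Steckin:
  fixes \<alpha> :: real
  assumes "0 \<le> \<alpha>" "\<alpha> \<le> 1"
  shows "real n * real (Suc n) powr \<alpha> \<le> (\<alpha> + 1) * (\<Sum>i=1..n. real i powr \<alpha>)"
proof (induction n)
  case 0
  show ?case by simp
next
  case (Suc n)
  define t where "t = real (Suc n)"
  have t: "t > 0"
    by (simp add: t_def)
  have "(t + 1) powr \<alpha> = t powr \<alpha> * (1 + 1 / t) powr \<alpha>"
    using t by (simp add: powr_mult[symmetric] distrib_left)
  also have "\<dots> \<le> t powr \<alpha> * (1 + \<alpha> * (1 / t))"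
    using powr_Bernoulli_le[of \<alpha> "1 / t"] assms t by (intro mult_left_mono) auto
  finally have "t * (t + 1) powr \<alpha> \<le> t powr \<alpha> * (t + \<alpha>)"
    using t by (simp add: field_simps)
  with Suc show ?case
    by (simp add: t_def algebra_simps)
qed

lemma power_weights_ratio:
  fixes \<alpha> :: real
  assumes \<alpha>: "0 \<le> \<alpha>" "\<alpha> \<le> 1" and n: "n \<ge> 1"
  defines "x \<equiv> \<lambda>n. (\<Sum>i=1..n. real i powr \<alpha>) / real n powr \<alpha>"
  shows "x n * ln (x (Suc n) / x n) \<le> 1 / (\<alpha> + 1)"
proof -
  define b where "b = \<alpha> + 1"
  define W where "W = (\<Sum>i=1..n. real i powr \<alpha>)"
  \<comment> \<open>\<open>q\<close> is the ratio of consecutive weights, so \<open>x\<close> obeys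
    the recursion \<open>x (Suc n) = 1 + x n / q\<close>.\<close>
  define q where "q = (1 + 1 / real n) powr \<alpha>"
  have b: "b > 0"
    using \<alpha> by (simp add: b_def)
  have n_powr: "real n powr \<alpha> > 0"
    using n by simp
  have "1 + 1 / real n > 0"
    by (simp add: add_pos_nonneg)
  then have q: "q > 0" "real (Suc n) powr \<alpha> = real n powr \<alpha> * q"
    using n by (auto simp: q_def powr_mult[symmetric] distrib_left add.commute)
  have "W > 0"
    unfolding W_def using n by (intro sum_pos) auto
  then have x_pos: "x n > 0"
    using n_powr by (simp add: x_def W_def)
  have "W \<le> (\<Sum>i=1..n. real n powr \<alpha>)"
    unfolding W_def using \<alpha> by (intro sum_mono powr_mono2) auto
  then have x_le: "x n \<le> real n"
    using n_powr by (simp add: x_def W_def divide_le_eq)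
  have x_ge: "real n * q \<le> b * x n"
    using Levin_Steckin[OF \<alpha>, of n] n_powr unfolding q(2)
    by (simp add: x_def b_def field_simps)
  have x_Suc: "x (Suc n) = 1 + x n / q"
    using n_powr q by (simp add: x_def field_simps)
  have "x (Suc n) - x n = 1 - x n * (q - 1) / q"
    using q(1) by (simp add: x_Suc field_simps)
  also have "\<dots> \<le> 1 - real n * (q - 1) / b"
  proof -
    have "q \<ge> 1"
      unfolding q_def using \<alpha> n by (simp add: ge_one_powr_ge_zero)
    then have "real n * q * (q - 1) \<le> b * x n * (q - 1)"
      using x_ge by (intro mult_right_mono) auto
    then show ?thesis
      using b q(1) by (simp add: field_simps)
  qed
  \<comment> \<open>The last term is what the quadratic Taylor term of
    \<open>x n * exp (1 / (b * x n))\<close> allows; the error of the lower Bernoulli bound has to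
    fit into it.\<close>
  also have "\<dots> \<le> 1 / b + 1 / (2 * b\<^sup>2 * x n)"
  proof -
    have "real n * (1 + \<alpha> * (1 / real n) - \<alpha> * (1 - \<alpha>) * (1 / real n)\<^sup>2) \<le> real n * q"
      unfolding q_def using \<alpha> by (intro mult_left_mono powr_Bernoulli_ge) auto
    moreover have "real n * (1 + \<alpha> * (1 / real n) - \<alpha> * (1 - \<alpha>) * (1 / real n)\<^sup>2)
        = real n + \<alpha> - \<alpha> * (1 - \<alpha>) / real n"
      using n by (simp add: field_simps power2_eq_square)
    ultimately have "\<alpha> - \<alpha> * (1 - \<alpha>) / real n \<le> real n * (q - 1)"
      by (simp add: right_diff_distrib)
    \<comment> \<open>Both sides are compared with \<open>1 / (4 * real n)\<close>, using
      \<open>b \<le> 2\<close> and \<open>x n \<le> real n\<close>.\<close>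
    moreover have "\<alpha> * (1 - \<alpha>) / real n \<le> 1 / (2 * b * x n)"
    proof -
      have "\<alpha> * (1 - \<alpha>) \<le> 1 / 4"
        using zero_le_power2[of "\<alpha> - 1 / 2"] by (simp add: power2_eq_square algebra_simps)
      moreover have "2 * b * x n \<le> 2 * 2 * real n"
        using \<alpha> b x_le x_pos by (intro mult_mono) (auto simp: b_def)
      then have "1 / (4 * real n) \<le> 1 / (2 * b * x n)"
        using b x_pos n by (intro divide_left_mono) auto
      ultimately show ?thesis
        using n divide_right_mono[of "\<alpha> * (1 - \<alpha>)" "1 / 4" "real n"] by simp
    qed
    ultimately have "\<alpha> - 1 / (2 * b * x n) \<le> real n * (q - 1)"
      by simp
    then have "(\<alpha> - 1 / (2 * b * x n)) / b \<le> real n * (q - 1) / b"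
      using b by (intro divide_right_mono) auto
    \<comment> \<open>The main term is \<open>1 / b\<close> because
      \<open>b - \<alpha> = 1\<close>.\<close>
    moreover have "1 - (\<alpha> - 1 / (2 * b * x n)) / b = 1 / b + 1 / (2 * b\<^sup>2 * x n)"
      using b x_pos by (simp add: field_simps power2_eq_square) (simp add: b_def algebra_simps)
    ultimately show ?thesis
      by linarith
  qed
  also have "1 / b + 1 / (2 * b\<^sup>2 * x n) = x n * (1 / (b * x n) + (1 / (b * x n))\<^sup>2 / 2)"
    using b x_pos by (simp add: field_simps power2_eq_square)
  finally have "x (Suc n) \<le> (1 + 1 / (b * x n) + (1 / (b * x n))\<^sup>2 / 2) * x n"
    by (simp add: algebra_simps)
  then have "x (Suc n) / x n \<le> 1 + 1 / (b * x n) + (1 / (b * x n))\<^sup>2 / 2"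
    using x_pos by (simp only: pos_divide_le_eq)
  also have "\<dots> \<le> exp (1 / (b * x n))"
    using b x_pos by (intro exp_lower_Taylor_quadratic) auto
  finally have le_exp: "x (Suc n) / x n \<le> exp (1 / (b * x n))" .
  have "x (Suc n) / x n > 0"
    using x_pos q(1) x_Suc by (simp add: add_pos_pos)
  with le_exp have "ln (x (Suc n) / x n) \<le> 1 / (b * x n)"
    by (metis exp_gt_zero ln_exp ln_le_cancel_iff)
  then have "x n * ln (x (Suc n) / x n) \<le> x n * (1 / (b * x n))"
    using x_pos by (intro mult_left_mono) auto
  then show ?thesis
    using x_pos by (simp add: b_def)
qed

theorem mainTheorem2:
  fixes \<alpha> :: real and a :: "nat \<Rightarrow> real"
  assumes "0 < \<alpha>" and "\<alpha> < 1"
    and "\<And>n. n \<ge> 1 \<Longrightarrow> a n \<ge> 0"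
    and "summable (\<lambda>n. a (Suc n))"
  shows "summable (\<lambda>n. weighted_geo_mean \<alpha> a (Suc n))
       \<and> (\<Sum>n. weighted_geo_mean \<alpha> a (Suc n)) \<le> exp (1 / (\<alpha> + 1)) * (\<Sum>n. a (Suc n))"
  using assms power_weights_ratio[of \<alpha>] weighted_carleman[of "\<lambda>n. real n powr \<alpha>" a "1 / (\<alpha> + 1)"]
  unfolding weighted_geo_mean_def by simp

end
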